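(* Let $d,m\ge 1$ be integers, let $X_1,\dots,X_m$ be self-adjoint $d\times d$ matrices, let $\lambda_1,\dots,\lambda_m\ge 0$ be real numbers with $\sum_{i=1}^m\lambda_i=1$, and let $M_1>0$ and $M_2$ be real numbers such that \[ \sum_{i=1}^m\lambda_iX_i=0,\qquad \|X_i\|\le M_1\ \text{ for all } i\in\{1,\dots,m\},\qquad \sum_{i=1}^m\lambda_iX_i^2\preceq M_2\,\mathrm{Id}_d. \] Fix $\delta>0$ and let $Y$ be any self-adjoint $d\times d$ matrix. Then \[ \sum_{i=1}^m\lambda_i F_\delta(Y+X_i)\le e^{M_2\psi_{M_1}(\delta)}F_\delta(Y). \] Consequently, there exists an index $i_*\in\{1,\dots,m\}$ such that \[ F_\delta(Y+X_{i_*})\le e^{M_2\psi_{M_1}(\delta)}F_\delta(Y). \]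
   Context: For $\delta>0$ and a self-adjoint matrix $Y$, the symmetric exponential potential is $F_\delta(Y):=\operatorname{trace} e^{\delta Y}+\operatorname{trace} e^{-\delta Y}$, where $e^{(\cdot)}$ is the matrix exponential. For $M_1>0$, \[ \psi_{M_1}(\delta):=\frac{e^{\delta M_1}-1-\delta M_1}{M_1^2}. \] $\|\cdot\|$ is the operator norm, $\mathrm{Id}_d$ is the $d\times d$ identity matrix, and $\preceq$ is the Löwner order on self-adjoint matrices ($A\preceq B$ iff $B-A$ is positive semidefinite). Self-adjoint means real symmetric or complex Hermitian. *)

theory Defs
  imports "HOL-Analysis.Analysis" "Jordan_Normal_Form.Conjugate"
begin

text \<open>
  The definitions are polymorphic in the scalars and are meant for real and complex matrices:
  \<open>conjugate\<close> is the identity on the reals and \<open>cnj\<close> on the complex numbers. The order on the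
  complex numbers is that of \<open>HOL-Library.Complex_Order\<close>: \<open>z \<le> w\<close> means that \<open>w - z\<close> is real
  and nonnegative.
\<close>

definition self_adjoint :: "'a::conjugatable_ring ^ 'n ^ 'n \<Rightarrow> bool" where
  "self_adjoint A \<longleftrightarrow> (\<forall>i j. A $ i $ j = conjugate (A $ j $ i))"

definition pos_semidef :: "'a::conjugatable_ordered_field ^ 'n ^ 'n \<Rightarrow> bool" where
  "pos_semidef A \<longleftrightarrow>
     self_adjoint A \<and> (\<forall>v. 0 \<le> (\<Sum>i\<in>UNIV. conjugate (v $ i) * (A *v v) $ i))"

definition loewner_le ::
    "'a::conjugatable_ordered_field ^ 'n ^ 'n \<Rightarrow> 'a ^ 'n ^ 'n \<Rightarrow> bool" (infix "\<preceq>\<^sub>L" 50) where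
  "A \<preceq>\<^sub>L B \<longleftrightarrow> pos_semidef (B - A)"

text \<open>
  The norm on \<open>'a ^ 'n\<close> is the Euclidean one, so this is the spectral norm, also for complex
  matrices.
\<close>

definition op_norm :: "'a::real_normed_field ^ 'n ^ 'n \<Rightarrow> real" where
  "op_norm A = onorm (\<lambda>v. A *v v)"

definition matrix_power :: "'a::semiring_1 ^ 'n ^ 'n \<Rightarrow> nat \<Rightarrow> 'a ^ 'n ^ 'n" where
  "matrix_power A k = (((**) A) ^^ k) (mat 1)"

text \<open>
  The overloaded \<open>exp\<close> is not available here, because \<open>'a ^ 'n ^ 'n\<close> is not an instance of
  \<open>real_normed_algebra_1\<close>.
\<close>

definition matrix_exp :: "'a::real_normed_field ^ 'n ^ 'n \<Rightarrow> 'a ^ 'n ^ 'n" where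
  "matrix_exp A = (\<Sum>k. matrix_power A k /\<^sub>R fact k)"

text \<open>
  The value lies in the scalar field; for self-adjoint complex \<open>Y\<close> it is a complex number with
  imaginary part zero.
\<close>

definition sym_exp_potential :: "real \<Rightarrow> 'a::real_normed_field ^ 'n ^ 'n \<Rightarrow> 'a" where
  "sym_exp_potential \<delta> Y =
     trace (matrix_exp (\<delta> *\<^sub>R Y)) + trace (matrix_exp (- (\<delta> *\<^sub>R Y)))"

definition psi :: "real \<Rightarrow> real \<Rightarrow> real" where
  "psi M\<^sub>1 \<delta> = (exp (\<delta> * M\<^sub>1) - 1 - \<delta> * M\<^sub>1) / M\<^sub>1\<^sup>2"

end

theory Submission
  imports Defs
begin

text \<open>
  The Golden--Thompson inequality \<open>tr (exp (A + B)) \<le> tr (exp A * exp B)\<close> separates \<open>Y\<close> from the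
  \<open>X i\<close>. Expanding \<open>exp (\<delta> X)\<close> and bounding \<open>X ^ (k + 2)\<close> by \<open>M\<^sub>1 ^ k X\<^sup>2\<close> as a quadratic form gives
  \<open>exp (\<delta> X) \<preceq> 1 + \<delta> X + \<psi> X\<^sup>2\<close>; averaged over \<open>i\<close>, the right-hand side is at most
  \<open>1 + M\<^sub>2 \<psi> \<le> exp (M\<^sub>2 \<psi>)\<close>. The summand with \<open>- \<delta>\<close> is the same statement for \<open>- Y\<close> and \<open>- X i\<close>.

  Golden--Thompson follows from the Lie product formula along \<open>n = 2 ^ k\<close> and the inequality
  \<open>tr ((P Q) ^ 2 ^ k) \<le> tr (P ^ 2 ^ k * Q ^ 2 ^ k)\<close> for self-adjoint \<open>P\<close>, \<open>Q\<close>. The latter is proved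
  by induction on \<open>k\<close> together with \<open>tr (M ^ 2 ^ (k + 1)) \<le> tr ((M M\<^sup>*) ^ 2 ^ k)\<close> for arbitrary \<open>M\<close>,
  each being applied to the other; no spectral theorem is needed.

  Real and complex matrices are treated at once, as real-linear operators on a Euclidean space.
\<close>

section \<open>The Lie product formula\<close>

lemma norm_power_diff_le:
  fixes x y :: "'a::real_normed_algebra_1"
  assumes "norm x \<le> c" "norm y \<le> c" "1 \<le> c"
  shows "norm (x ^ n - y ^ n) \<le> real n * c ^ n * norm (x - y)"
proof (induction n)
  case 0
  then show ?case by simp
next
  case (Suc n)
  have "x ^ Suc n - y ^ Suc n = x * (x ^ n - y ^ n) + (x - y) * y ^ n"
    by (simp add: algebra_simps)
  then have "norm (x ^ Suc n - y ^ Suc n) \<le> norm x * norm (x ^ n - y ^ n) + norm (x - y) * norm (y ^ n)"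
    by (metis add_mono norm_mult_ineq norm_triangle_le)
  also have "\<dots> \<le> c * (real n * c ^ n * norm (x - y)) + norm (x - y) * c ^ Suc n"
  proof (intro add_mono mult_mono)
    have "norm (y ^ n) \<le> norm y ^ n" by (rule norm_power_ineq)
    also have "\<dots> \<le> c ^ n" using assms by (intro power_mono) auto
    also have "\<dots> \<le> c ^ Suc n" using assms by (intro power_increasing) auto
    finally show "norm (y ^ n) \<le> c ^ Suc n" .
  qed (use Suc assms in auto)
  also have "\<dots> = real (Suc n) * c ^ Suc n * norm (x - y)"
    by (simp add: algebra_simps)
  finally show ?case .
qed

lemma exp_scaleR_of_nat:
  fixes x :: "'a::{real_normed_algebra_1,banach}"
  shows "exp (real n *\<^sub>R x) = exp x ^ n"
proof (induction n)
  case (Suc n)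
  have "real (Suc n) *\<^sub>R x = x + real n *\<^sub>R x"
    by (simp add: scaleR_left_distrib)
  then show ?case
    using Suc by (simp add: exp_add_commuting)
qed simp

lemma Lie_product_formula:
  fixes A B :: "'a::{real_normed_algebra_1,banach}"
  shows "(\<lambda>n. (exp (A /\<^sub>R real n) * exp (B /\<^sub>R real n)) ^ n) \<longlonglongrightarrow> exp (A + B)"
proof -
  define f where "f t = exp (t *\<^sub>R A) * exp (t *\<^sub>R B) - exp (t *\<^sub>R (A + B))" for t :: real
  define e where "e n = norm (f (inverse (real n))) / inverse (real n)" for n
  define c where "c n = exp ((norm A + norm B) / real n)" for n
  have "(f has_vector_derivative
      (exp (0 *\<^sub>R A) * (exp (0 *\<^sub>R B) * B) + (exp (0 *\<^sub>R A) * A) * exp (0 *\<^sub>R B))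
        - exp (0 *\<^sub>R (A + B)) * (A + B)) (at 0)"
    unfolding f_def
    by (intro has_vector_derivative_diff has_vector_derivative_mult
        exp_scaleR_has_vector_derivative_right)
  then have "(f has_derivative (\<lambda>t. t *\<^sub>R 0)) (at 0)"
    by (simp add: has_vector_derivative_def)
  then have lim: "((\<lambda>t. norm (f t) / norm t) \<longlongrightarrow> 0) (at 0)"
    by (simp add: has_derivative_iff_norm f_def)
  have "filterlim (\<lambda>n. inverse (real n)) (at 0) sequentially"
    by (auto simp: filterlim_at eventually_sequentially
        intro!: LIMSEQ_inverse_real_of_nat[THEN LIMSEQ_imp_Suc] exI[of _ 1])
  then have "(\<lambda>n. norm (f (inverse (real n))) / norm (inverse (real n))) \<longlonglongrightarrow> 0"
    by (rule filterlim_compose[OF lim])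
  then have e0: "e \<longlonglongrightarrow> 0"
    by (simp add: e_def[abs_def])
  have bound: "norm ((exp (A /\<^sub>R real n) * exp (B /\<^sub>R real n)) ^ n - exp (A + B))
      \<le> exp (norm A + norm B) * e n" if "n \<ge> 1" for n
  proof -
    have exp_le: "norm (exp (D /\<^sub>R real n)) \<le> exp (norm D / real n)" for D :: 'a
      using norm_exp[of "D /\<^sub>R real n"] by (simp add: divide_inverse mult.commute)
    have "norm (exp (A /\<^sub>R real n) * exp (B /\<^sub>R real n)) \<le> exp (norm A / real n) * exp (norm B / real n)"
      by (meson exp_ge_zero exp_le mult_mono norm_ge_zero norm_mult_ineq order_trans)
    then have 1: "norm (exp (A /\<^sub>R real n) * exp (B /\<^sub>R real n)) \<le> c n"
      by (simp add: c_def exp_add[symmetric] add_divide_distrib)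
    have 2: "norm (exp ((A + B) /\<^sub>R real n)) \<le> c n"
      unfolding c_def by (rule order_trans[OF exp_le]) (simp add: divide_right_mono norm_triangle_ineq)
    have "exp (A + B) = exp ((A + B) /\<^sub>R real n) ^ n"
      using that by (simp flip: exp_scaleR_of_nat)
    then have "norm ((exp (A /\<^sub>R real n) * exp (B /\<^sub>R real n)) ^ n - exp (A + B))
        \<le> real n * c n ^ n * norm (f (inverse (real n)))"
      using norm_power_diff_le[OF 1 2, of n] by (simp add: c_def f_def)
    also have "c n ^ n = exp (norm A + norm B)"
      using that by (simp add: c_def flip: exp_of_nat_mult)
    finally show ?thesis
      by (simp add: e_def divide_inverse mult_ac)
  qed
  have "(\<lambda>n. exp (norm A + norm B) * e n) \<longlonglongrightarrow> 0"
    using tendsto_mult_right_zero[OF e0] by simp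
  then have "(\<lambda>n. (exp (A /\<^sub>R real n) * exp (B /\<^sub>R real n)) ^ n - exp (A + B)) \<longlonglongrightarrow> 0"
    by (rule Lim_null_comparison[rotated]) (use bound in \<open>auto simp: eventually_sequentially\<close>)
  then show ?thesis
    by (simp add: LIM_zero_iff)
qed


section \<open>The Banach algebra of operators on a Euclidean space\<close>

typedef (overloaded) 'a endo = "UNIV :: ('a::euclidean_space \<Rightarrow>\<^sub>L 'a) set"
  morphisms blinfun_of_endo endo_of_blinfun ..

setup_lifting type_definition_endo

instantiation endo :: (euclidean_space) real_normed_algebra_1
begin

lift_definition zero_endo :: "'a endo" is 0 .
lift_definition one_endo :: "'a endo" is id_blinfun .
lift_definition plus_endo :: "'a endo \<Rightarrow> 'a endo \<Rightarrow> 'a endo" is "(+)" .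
lift_definition minus_endo :: "'a endo \<Rightarrow> 'a endo \<Rightarrow> 'a endo" is "(-)" .
lift_definition uminus_endo :: "'a endo \<Rightarrow> 'a endo" is uminus .
lift_definition times_endo :: "'a endo \<Rightarrow> 'a endo \<Rightarrow> 'a endo" is "(o\<^sub>L)" .
lift_definition scaleR_endo :: "real \<Rightarrow> 'a endo \<Rightarrow> 'a endo" is "(*\<^sub>R)" .
lift_definition norm_endo :: "'a endo \<Rightarrow> real" is norm .

definition dist_endo :: "'a endo \<Rightarrow> 'a endo \<Rightarrow> real"
  where "dist_endo A B = norm (A - B)"

definition sgn_endo :: "'a endo \<Rightarrow> 'a endo"
  where "sgn_endo A = inverse (norm A) *\<^sub>R A"

definition "(uniformity :: ('a endo \<times> 'a endo) filter)
  = (INF e\<in>{0 <..}. principal {(A, B). dist A B < e})"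

definition open_endo :: "'a endo set \<Rightarrow> bool"
  where "open_endo S = (\<forall>A\<in>S. \<forall>\<^sub>F (A', B) in uniformity. A' = A \<longrightarrow> B \<in> S)"

instance
proof
  show "uniformity = (INF e\<in>{0<..}. principal {(A :: 'a endo, B). dist A B < e})"
    by (simp add: uniformity_endo_def)
  show "open S = (\<forall>A\<in>S. \<forall>\<^sub>F (A', B) in uniformity. A' = A \<longrightarrow> B \<in> S)" for S :: "'a endo set"
    by (simp add: open_endo_def)
  show "dist A B = norm (A - B)" "sgn A = inverse (norm A) *\<^sub>R A" for A B :: "'a endo"
    by (simp_all add: dist_endo_def sgn_endo_def)
  fix A B C :: "'a endo" and r s :: real
  show "A + B + C = A + (B + C)" "A + B = B + A" "0 + A = A" "- A + A = 0" "A - B = A + - B"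
    by (transfer; simp)+
  show "r *\<^sub>R (A + B) = r *\<^sub>R A + r *\<^sub>R B" "(r + s) *\<^sub>R A = r *\<^sub>R A + s *\<^sub>R A"
    "r *\<^sub>R s *\<^sub>R A = (r * s) *\<^sub>R A" "1 *\<^sub>R A = A"
    by (transfer; simp add: algebra_simps)+
  show "A * B * C = A * (B * C)" "1 * A = A" "A * 1 = A" "(A + B) * C = A * C + B * C"
    "A * (B + C) = A * B + A * C" "r *\<^sub>R A * B = r *\<^sub>R (A * B)" "A * r *\<^sub>R B = r *\<^sub>R (A * B)"
    by (transfer; auto intro!: blinfun_eqI simp: blinfun.bilinear_simps)+
  show "(norm A = 0) = (A = 0)" "norm (A + B) \<le> norm A + norm B" "norm (r *\<^sub>R A) = \<bar>r\<bar> * norm A"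
    "norm (A * B) \<le> norm A * norm B" "norm (1 :: 'a endo) = 1"
    by (transfer; simp add: norm_triangle_ineq norm_blinfun_compose)+
  show "(0 :: 'a endo) \<noteq> 1"
    by transfer (metis norm_blinfun_id norm_zero zero_neq_one)
qed

end

lemma dist_endo_of_blinfun: "dist (endo_of_blinfun f) (endo_of_blinfun g) = dist f g"
  by (simp add: dist_norm norm_endo.rep_eq minus_endo.rep_eq endo_of_blinfun_inverse)

instance endo :: (euclidean_space) banach
proof
  fix X :: "nat \<Rightarrow> 'a endo"
  assume "Cauchy X"
  then have "Cauchy (\<lambda>n. blinfun_of_endo (X n))"
    by (simp add: Cauchy_def blinfun_of_endo_inverse flip: dist_endo_of_blinfun)
  then obtain f where "(\<lambda>n. blinfun_of_endo (X n)) \<longlonglongrightarrow> f"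
    using Cauchy_convergent convergent_def by blast
  then have "X \<longlonglongrightarrow> endo_of_blinfun f"
    by (simp add: LIMSEQ_def blinfun_of_endo_inverse flip: dist_endo_of_blinfun)
  then show "convergent X"
    by (rule convergentI)
qed

lift_definition endo_apply :: "'a::euclidean_space endo \<Rightarrow> 'a \<Rightarrow> 'a" (infixr "\<cdot>" 75) is blinfun_apply .

lift_definition Endo :: "('a::euclidean_space \<Rightarrow> 'a) \<Rightarrow> 'a endo" is Blinfun .

lemma endo_eqI: "(\<And>x. A \<cdot> x = B \<cdot> x) \<Longrightarrow> A = B"
  by transfer (rule blinfun_eqI)

lemma Endo_apply [simp]: "linear f \<Longrightarrow> Endo f \<cdot> x = f x"
  by transfer (simp add: bounded_linear_Blinfun_apply linear_conv_bounded_linear)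

lemma bounded_bilinear_endo_apply: "bounded_bilinear (\<cdot>)"
proof
  fix A B :: "'a endo" and x y :: 'a and r :: real
  show "(A + B) \<cdot> x = A \<cdot> x + B \<cdot> x" "A \<cdot> (x + y) = A \<cdot> x + A \<cdot> y"
    "(r *\<^sub>R A) \<cdot> x = r *\<^sub>R (A \<cdot> x)" "A \<cdot> (r *\<^sub>R x) = r *\<^sub>R (A \<cdot> x)"
    by (transfer; simp add: blinfun.bilinear_simps)+
next
  show "\<exists>K. \<forall>(A :: 'a endo) x. norm (A \<cdot> x) \<le> norm A * norm x * K"
    by (intro exI[of _ 1] allI, transfer) (simp add: norm_blinfun)
qed

interpretation endo: bounded_bilinear endo_apply
  by (rule bounded_bilinear_endo_apply)

lemma one_endo_apply [simp]: "1 \<cdot> x = x"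
  by transfer simp

lemma times_endo_apply [simp]: "(A * B) \<cdot> x = A \<cdot> B \<cdot> x"
  by transfer simp

lemma norm_endo_apply: "norm (A \<cdot> x) \<le> norm A * norm x"
  by transfer (rule norm_blinfun)

lemma norm_endo_eq_onorm: "norm A = onorm ((\<cdot>) A)"
  by transfer (rule norm_blinfun.rep_eq)

lemma linear_endo_apply: "linear ((\<cdot>) A)"
  using endo.bounded_linear_right by (rule bounded_linear.linear)


section \<open>Adjoint and trace\<close>

definition adj :: "'a::euclidean_space endo \<Rightarrow> 'a endo" where
  "adj A = Endo (adjoint ((\<cdot>) A))"

definition selfadj :: "'a::euclidean_space endo \<Rightarrow> bool" where
  "selfadj A \<longleftrightarrow> (\<forall>x y. (A \<cdot> x) \<bullet> y = x \<bullet> (A \<cdot> y))"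

definition tr :: "'a::euclidean_space endo \<Rightarrow> real" where
  "tr A = (\<Sum>b\<in>Basis. (A \<cdot> b) \<bullet> b)"

lemma adj_inner: "x \<bullet> (adj A \<cdot> y) = (A \<cdot> x) \<bullet> y"
  by (simp add: adj_def adjoint_works adjoint_linear linear_endo_apply)

lemma adj_inner': "(adj A \<cdot> y) \<bullet> x = y \<bullet> (A \<cdot> x)"
  using adj_inner[of x A y] by (simp add: inner_commute)

lemma adj_unique: "(\<And>x y. x \<bullet> (B \<cdot> y) = (A \<cdot> x) \<bullet> y) \<Longrightarrow> adj A = B"
  by (rule endo_eqI) (metis adj_inner vector_eq_ldot)

lemma adj_times: "adj (A * B) = adj B * adj A"
  by (rule adj_unique) (simp add: adj_inner)

lemma adj_adj: "adj (adj A) = A"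
  by (rule adj_unique) (simp add: adj_inner')

lemma adj_one: "adj 1 = 1"
  by (rule adj_unique) simp

lemma selfadj_iff_adj: "selfadj A \<longleftrightarrow> adj A = A"
  unfolding selfadj_def by (metis adj_inner adj_unique)

lemma selfadj_times_adj: "selfadj (A * adj A)" "selfadj (adj A * A)"
  by (simp_all add: selfadj_iff_adj adj_times adj_adj)

lemma selfadj_scaleR: "selfadj A \<Longrightarrow> selfadj (r *\<^sub>R A)"
  by (simp add: selfadj_def endo.scaleR_left)

lemma selfadj_uminus: "selfadj A \<Longrightarrow> selfadj (- A)"
  by (simp add: selfadj_def endo.minus_left)

lemma selfadj_diff: "selfadj A \<Longrightarrow> selfadj B \<Longrightarrow> selfadj (A - B)"
  by (simp add: selfadj_def endo.diff_left inner_diff)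

lemma selfadj_power: "selfadj A \<Longrightarrow> selfadj (A ^ n)"
  by (induction n) (simp_all add: selfadj_iff_adj adj_times adj_one power_commutes)

lemma selfadj_exp:
  assumes "selfadj A"
  shows "selfadj (exp A)"
  unfolding selfadj_def
proof (intro allI)
  fix x y
  have "(\<lambda>n. ((A ^ n /\<^sub>R fact n) \<cdot> x) \<bullet> y) sums ((exp A \<cdot> x) \<bullet> y)"
    "(\<lambda>n. x \<bullet> ((A ^ n /\<^sub>R fact n) \<cdot> y)) sums (x \<bullet> (exp A \<cdot> y))"
    by (intro bounded_linear.sums[OF _ exp_converges]
        bounded_linear_compose[OF bounded_linear_inner_left endo.bounded_linear_left]
        bounded_linear_compose[OF bounded_linear_inner_right endo.bounded_linear_left])+
  moreover have "((A ^ n /\<^sub>R fact n) \<cdot> x) \<bullet> y = x \<bullet> ((A ^ n /\<^sub>R fact n) \<cdot> y)" for n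
    using selfadj_scaleR[OF selfadj_power[OF assms]] by (auto simp: selfadj_def)
  ultimately show "(exp A \<cdot> x) \<bullet> y = x \<bullet> (exp A \<cdot> y)"
    using sums_unique2 by fastforce
qed

lemma bounded_linear_tr: "bounded_linear tr"
  unfolding tr_def
  by (intro bounded_linear_sum
      bounded_linear_compose[OF bounded_linear_inner_left endo.bounded_linear_left])

lemmas linear_tr = bounded_linear.linear[OF bounded_linear_tr]
lemmas tr_add = linear_add[OF linear_tr]
lemmas tr_diff = linear_diff[OF linear_tr]

lemma tr_commute: "tr (A * B) = tr (B * A)"
proof -
  have *: "tr (A * B) = (\<Sum>b\<in>Basis. \<Sum>c\<in>Basis. ((B \<cdot> b) \<bullet> c) * ((A \<cdot> c) \<bullet> b))" for A B :: "'a endo"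
  proof -
    have "(A \<cdot> B \<cdot> b) \<bullet> b = (\<Sum>c\<in>Basis. ((B \<cdot> b) \<bullet> c) * ((A \<cdot> c) \<bullet> b))" for b
    proof -
      have "A \<cdot> B \<cdot> b = A \<cdot> (\<Sum>c\<in>Basis. ((B \<cdot> b) \<bullet> c) *\<^sub>R c)"
        by (simp add: euclidean_representation)
      then show ?thesis
        by (simp add: endo.sum_right endo.scaleR_right inner_sum_left)
    qed
    then show ?thesis by (simp add: tr_def)
  qed
  show ?thesis
    unfolding * by (subst sum.swap) (simp add: mult.commute)
qed

lemma tr_power_commute: "tr ((A * B) ^ n) = tr ((B * A) ^ n)"
proof (cases n)
  case (Suc k)
  have swap: "(A * B) ^ k * A = A * (B * A) ^ k"
    by (induction k) (simp_all add: mult.assoc)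
  have "tr ((A * B) ^ n) = tr ((A * B) ^ k * A * B)"
    by (simp add: Suc power_Suc2 mult.assoc del: power_Suc)
  also have "\<dots> = tr (B * (A * (B * A) ^ k))"
    by (subst tr_commute) (simp add: swap)
  finally show ?thesis
    by (simp add: Suc mult.assoc)
qed simp

lemma tr_adj: "tr (adj A) = tr A"
  unfolding tr_def adj_inner' by (simp add: inner_commute)

lemma tr_times_adj_nonneg: "0 \<le> tr (A * adj A)"
  unfolding tr_def by (intro sum_nonneg) (metis adj_inner inner_ge_zero times_endo_apply)

lemma tr_square_le: "tr (A * A) \<le> tr (A * adj A)"
proof -
  define B where "B = adj A - A"
  have adjB: "adj B = A - adj A"
    by (rule adj_unique) (simp add: B_def endo.diff_left inner_diff adj_inner adj_inner')
  have "tr (B * adj B) = 2 * (tr (A * adj A) - tr (A * A))"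
    using tr_commute[of A "adj A"] tr_adj[of "A * A"]
    unfolding adjB unfolding B_def by (simp add: algebra_simps tr_add tr_diff adj_times)
  then show ?thesis
    using tr_times_adj_nonneg[of B] by simp
qed

lemma tr_times_le:
  assumes "selfadj A" "selfadj B"
  shows "tr (A * B) \<le> (tr (A * A) + tr (B * B)) / 2"
proof -
  have "0 \<le> tr ((A - B) * (A - B))"
    using tr_times_adj_nonneg[of "A - B"] selfadj_diff[OF assms] by (simp add: selfadj_iff_adj)
  also have "\<dots> = tr (A * A) + tr (B * B) - 2 * tr (A * B)"
    using tr_commute[of A B] by (simp add: algebra_simps tr_diff tr_add)
  finally show ?thesis by simp
qed


section \<open>The Golden--Thompson inequality\<close>

lemma tr_power_times_step:
  assumes S: "\<And>M :: 'a::euclidean_space endo. tr (M ^ 2 ^ Suc k) \<le> tr ((M * adj M) ^ 2 ^ k)"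
    and G: "\<And>P Q :: 'a endo. selfadj P \<Longrightarrow> selfadj Q \<Longrightarrow> tr ((P * Q) ^ 2 ^ k) \<le> tr (P ^ 2 ^ k * Q ^ 2 ^ k)"
    and "selfadj P" "selfadj (Q :: 'a endo)"
  shows "tr ((P * Q) ^ 2 ^ Suc k) \<le> tr (P ^ 2 ^ Suc k * Q ^ 2 ^ Suc k)"
proof -
  have "tr ((P * Q) ^ 2 ^ Suc k) \<le> tr ((P * Q * Q * P) ^ 2 ^ k)"
    using S[of "P * Q"] assms(3,4) by (simp add: adj_times selfadj_iff_adj mult.assoc)
  also have "\<dots> = tr ((P\<^sup>2 * Q\<^sup>2) ^ 2 ^ k)"
    using tr_power_commute[of "P * Q * Q" P] by (simp add: power2_eq_square mult.assoc)
  also have "\<dots> \<le> tr ((P\<^sup>2) ^ 2 ^ k * (Q\<^sup>2) ^ 2 ^ k)"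
    by (intro G selfadj_power assms)
  finally show ?thesis
    by (simp add: power_mult)
qed

lemma
  fixes M P Q :: "'a::euclidean_space endo"
  shows tr_power_two_power_le: "tr (M ^ 2 ^ Suc k) \<le> tr ((M * adj M) ^ 2 ^ k)"
    and tr_power_times_le: "selfadj P \<Longrightarrow> selfadj Q \<Longrightarrow> tr ((P * Q) ^ 2 ^ k) \<le> tr (P ^ 2 ^ k * Q ^ 2 ^ k)"
proof (induction k arbitrary: M P Q)
  case 0
  {
    case 1
    show ?case using tr_square_le[of M] by (simp add: power2_eq_square)
  next
    case 2
    show ?case by simp
  }
next
  case (Suc k)
  {
    case 1
    let ?P = "adj M * M" and ?Q = "M * adj M"
    have "tr (M ^ 2 ^ Suc (Suc k)) = tr ((M * M) ^ 2 ^ Suc k)"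
      by (simp only: power_Suc[of 2 "Suc k"] power_mult power2_eq_square)
    also have "\<dots> \<le> tr ((M * M * adj M * adj M) ^ 2 ^ k)"
      using Suc.IH(1)[of "M * M"] by (simp add: adj_times mult.assoc)
    also have "\<dots> = tr ((?P * ?Q) ^ 2 ^ k)"
      using tr_power_commute[of "M * M * adj M" "adj M"] by (simp add: mult.assoc)
    also have "\<dots> \<le> tr (?P ^ 2 ^ k * ?Q ^ 2 ^ k)"
      by (intro Suc.IH(2) selfadj_times_adj)
    also have "\<dots> \<le> (tr (?P ^ 2 ^ k * ?P ^ 2 ^ k) + tr (?Q ^ 2 ^ k * ?Q ^ 2 ^ k)) / 2"
      by (intro tr_times_le selfadj_power selfadj_times_adj)
    also have "\<dots> = (tr (?P ^ 2 ^ Suc k) + tr (?Q ^ 2 ^ Suc k)) / 2"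
      by (simp add: mult_2 power_add)
    also have "\<dots> = tr (?Q ^ 2 ^ Suc k)"
      by (simp add: tr_power_commute[of "adj M" M])
    finally show ?case .
  next
    case 2
    show ?case by (rule tr_power_times_step[OF Suc.IH 2])
  }
qed

theorem Golden_Thompson:
  assumes "selfadj A" "selfadj B"
  shows "tr (exp (A + B)) \<le> tr (exp A * exp B)"
proof (rule LIMSEQ_le_const2)
  have "filterlim (\<lambda>k. 2 ^ k :: nat) at_top sequentially"
    by (intro filterlim_subseq strict_monoI) simp
  then show "(\<lambda>k. tr ((exp (A /\<^sub>R real (2 ^ k)) * exp (B /\<^sub>R real (2 ^ k))) ^ 2 ^ k)) \<longlonglongrightarrow> tr (exp (A + B))"
    by (intro bounded_linear.tendsto[OF bounded_linear_tr] filterlim_compose[OF Lie_product_formula])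
  have root: "exp (D /\<^sub>R real (2 ^ k)) ^ 2 ^ k = exp D" for D :: "'a endo" and k
    by (simp flip: exp_scaleR_of_nat)
  show "\<exists>N. \<forall>k\<ge>N. tr ((exp (A /\<^sub>R real (2 ^ k)) * exp (B /\<^sub>R real (2 ^ k))) ^ 2 ^ k) \<le> tr (exp A * exp B)"
    using tr_power_times_le[OF selfadj_exp[OF selfadj_scaleR[OF assms(1)]]
        selfadj_exp[OF selfadj_scaleR[OF assms(2)]]]
    by (metis root)
qed


section \<open>The potential inequality for operators\<close>

lemma psi_nonneg: "0 \<le> psi M \<delta>"
  unfolding psi_def using exp_ge_add_one_self[of "\<delta> * M"]
  by (intro divide_nonneg_nonneg) (simp_all add: algebra_simps)

lemma exp_quadratic_form_le:
  assumes "selfadj X" "norm X \<le> M" "0 < M" "0 \<le> \<delta>"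
  shows "v \<bullet> (exp (\<delta> *\<^sub>R X) \<cdot> v) \<le> v \<bullet> v + \<delta> * (v \<bullet> (X \<cdot> v)) + psi M \<delta> * (v \<bullet> ((X * X) \<cdot> v))"
proof -
  define q where "q = v \<bullet> ((X * X) \<cdot> v)"
  define w where "w = q / M\<^sup>2"
  define a where "a k = v \<bullet> (((\<delta> *\<^sub>R X) ^ k /\<^sub>R fact k) \<cdot> v)" for k
  define b where "b k = ((\<delta> * M) ^ k /\<^sub>R fact k) * w + (if k = 0 then v \<bullet> v - w else 0)
    + (if k = 1 then \<delta> * (v \<bullet> (X \<cdot> v)) - \<delta> * M * w else 0)" for k
  have q: "q = (norm (X \<cdot> v))\<^sup>2"
    using assms(1) by (simp add: q_def selfadj_def power2_norm_eq_inner)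
  have a_sums: "a sums (v \<bullet> (exp (\<delta> *\<^sub>R X) \<cdot> v))"
    unfolding a_def
    by (intro bounded_linear.sums[OF _ exp_converges]
        bounded_linear_compose[OF bounded_linear_inner_right endo.bounded_linear_left])
  have b_sums: "b sums (exp (\<delta> * M) * w + (v \<bullet> v - w) + (\<delta> * (v \<bullet> (X \<cdot> v)) - \<delta> * M * w))"
    unfolding b_def by (intro sums_add sums_mult2 exp_converges sums_single)
  have "a k \<le> b k" for k
  proof -
    consider "k = 0" | "k = 1" | j where "k = Suc (Suc j)"
      by (metis One_nat_def not0_implies_Suc)
    then show ?thesis
    proof cases
      case 3
      have "v \<bullet> (X ^ k \<cdot> v) = (X \<cdot> v) \<bullet> (X ^ j \<cdot> X \<cdot> v)"
        using assms(1) unfolding 3 power_Suc[of _ "Suc j"] power_Suc2[of _ j]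
        by (simp add: selfadj_def del: power_Suc)
      also have "\<dots> \<le> norm (X \<cdot> v) * (norm (X ^ j) * norm (X \<cdot> v))"
        by (meson norm_cauchy_schwarz norm_endo_apply mult_left_mono norm_ge_zero order_trans)
      also have "\<dots> = norm (X ^ j) * q"
        by (simp add: q power2_eq_square)
      also have "\<dots> \<le> M ^ j * q"
      proof (rule mult_right_mono)
        show "norm (X ^ j) \<le> M ^ j"
          by (meson assms(2) norm_ge_zero norm_power_ineq order_trans power_mono)
      qed (simp add: q)
      also have "\<dots> = M ^ k * w"
        using assms(3) by (simp add: w_def 3 power2_eq_square)
      finally have "(\<delta> ^ k / fact k) * (v \<bullet> (X ^ k \<cdot> v)) \<le> (\<delta> ^ k / fact k) * (M ^ k * w)"
        using assms(4) by (intro mult_left_mono) auto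
      moreover have "k \<noteq> 0" "k \<noteq> 1"
        using 3 by simp_all
      ultimately show ?thesis
        by (simp add: a_def b_def endo.scaleR_left power_mult_distrib divide_inverse mult_ac)
    qed (simp_all add: a_def b_def endo.scaleR_left)
  qed
  then have "v \<bullet> (exp (\<delta> *\<^sub>R X) \<cdot> v) \<le> exp (\<delta> * M) * w + (v \<bullet> v - w) + (\<delta> * (v \<bullet> (X \<cdot> v)) - \<delta> * M * w)"
    using sums_le[OF _ a_sums b_sums] by blast
  also have "\<dots> = v \<bullet> v + \<delta> * (v \<bullet> (X \<cdot> v)) + psi M \<delta> * q"
    using assms(3) by (simp add: psi_def w_def field_simps)
  finally show ?thesis
    by (simp add: q_def)
qed

lemma tr_exp_times:
  assumes "selfadj Y"
  shows "tr (exp Y * K) = (\<Sum>b\<in>Basis. (exp (Y /\<^sub>R 2) \<cdot> b) \<bullet> (K \<cdot> exp (Y /\<^sub>R 2) \<cdot> b))"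
proof -
  let ?H = "exp (Y /\<^sub>R 2)"
  have "Y /\<^sub>R 2 + Y /\<^sub>R 2 = Y"
    by (simp flip: scaleR_left_distrib)
  then have "exp Y = ?H * ?H"
    by (metis exp_add_commuting)
  then have "tr (exp Y * K) = tr (?H * (K * ?H))"
    by (metis mult.assoc tr_commute)
  also have "(?H \<cdot> K \<cdot> ?H \<cdot> b) \<bullet> b = (?H \<cdot> b) \<bullet> (K \<cdot> ?H \<cdot> b)" for b
    using selfadj_exp[OF selfadj_scaleR[OF assms, of "inverse 2"]]
    unfolding selfadj_def by (metis inner_commute)
  then have "tr (?H * (K * ?H)) = (\<Sum>b\<in>Basis. (?H \<cdot> b) \<bullet> (K \<cdot> ?H \<cdot> b))"
    by (simp add: tr_def)
  finally show ?thesis .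
qed

theorem sum_tr_exp_le:
  assumes l: "\<And>i. i \<in> I \<Longrightarrow> 0 \<le> l i" "sum l I = 1"
    and X: "\<And>i. i \<in> I \<Longrightarrow> selfadj (X i)" "\<And>i. i \<in> I \<Longrightarrow> norm (X i) \<le> M"
    and mean: "(\<Sum>i\<in>I. l i *\<^sub>R X i) = 0"
    and var: "\<And>v. v \<bullet> ((\<Sum>i\<in>I. l i *\<^sub>R (X i * X i)) \<cdot> v) \<le> M' * (v \<bullet> v)"
    and "selfadj Y" "0 < M" "0 \<le> \<delta>"
  shows "(\<Sum>i\<in>I. l i * tr (exp (\<delta> *\<^sub>R (Y + X i)))) \<le> exp (M' * psi M \<delta>) * tr (exp (\<delta> *\<^sub>R Y))"
proof -
  let ?Y = "\<delta> *\<^sub>R Y"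
  define q where "q b = exp (?Y /\<^sub>R 2) \<cdot> b" for b
  have sY: "selfadj ?Y"
    using \<open>selfadj Y\<close> by (rule selfadj_scaleR)
  note trY = tr_exp_times[OF sY, folded q_def]
  have trY1: "tr (exp ?Y) = (\<Sum>b\<in>Basis. q b \<bullet> q b)"
    using trY[of 1] by simp
  have pointwise: "(\<Sum>i\<in>I. l i * (v \<bullet> (exp (\<delta> *\<^sub>R X i) \<cdot> v))) \<le> (1 + M' * psi M \<delta>) * (v \<bullet> v)" for v
  proof -
    have "(\<Sum>i\<in>I. l i * (v \<bullet> (exp (\<delta> *\<^sub>R X i) \<cdot> v)))
        \<le> (\<Sum>i\<in>I. l i * (v \<bullet> v + \<delta> * (v \<bullet> (X i \<cdot> v)) + psi M \<delta> * (v \<bullet> ((X i * X i) \<cdot> v))))"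
      using assms by (intro sum_mono mult_left_mono exp_quadratic_form_le) auto
    also have "\<dots> = sum l I * (v \<bullet> v) + \<delta> * (v \<bullet> ((\<Sum>i\<in>I. l i *\<^sub>R X i) \<cdot> v))
        + psi M \<delta> * (v \<bullet> ((\<Sum>i\<in>I. l i *\<^sub>R (X i * X i)) \<cdot> v))"
      by (simp add: endo.sum_left endo.scaleR_left inner_sum_right sum_distrib_left sum_distrib_right
          sum.distrib distrib_left mult.left_commute del: times_endo_apply)
    also have "\<dots> \<le> v \<bullet> v + psi M \<delta> * (M' * (v \<bullet> v))"
      using mult_left_mono[OF var[of v] psi_nonneg[of M \<delta>]] by (simp add: l mean endo.zero_left)
    finally show ?thesis
      by (simp add: algebra_simps)
  qed
  have "(\<Sum>i\<in>I. l i * tr (exp (\<delta> *\<^sub>R (Y + X i)))) \<le> (\<Sum>i\<in>I. l i * tr (exp ?Y * exp (\<delta> *\<^sub>R X i)))"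
    using l X sY unfolding scaleR_right_distrib
    by (intro sum_mono mult_left_mono Golden_Thompson selfadj_scaleR[of "X _"]) auto
  also have "\<dots> = (\<Sum>b\<in>Basis. \<Sum>i\<in>I. l i * (q b \<bullet> (exp (\<delta> *\<^sub>R X i) \<cdot> q b)))"
    unfolding trY sum_distrib_left by (rule sum.swap)
  also have "\<dots> \<le> (\<Sum>b\<in>Basis. (1 + M' * psi M \<delta>) * (q b \<bullet> q b))"
    by (intro sum_mono pointwise)
  also have "\<dots> = (1 + M' * psi M \<delta>) * tr (exp ?Y)"
    by (simp add: trY1 sum_distrib_left)
  also have "\<dots> \<le> exp (M' * psi M \<delta>) * tr (exp ?Y)"
    by (intro mult_right_mono exp_ge_add_one_self) (simp add: trY1 sum_nonneg)
  finally show ?thesis .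
qed


section \<open>Matrices as operators\<close>

text \<open>
  The complex numbers are a two-dimensional real inner product space here: \<open>1 \<bullet> z\<close> is the real part
  of \<open>z\<close>, and the trace of a complex matrix as a real operator is twice the real part of its trace.
\<close>

class star_scalar = real_normed_field + euclidean_space + conjugatable_ordered_field +
  assumes inner_mult_conjugate: "x \<bullet> (c * y) = (conjugate c * x) \<bullet> y"
    and sum_Basis_inner_mult: "(\<Sum>b\<in>Basis. (c * b) \<bullet> b) = real (card Basis) * (1 \<bullet> c)"
    and less_eq_iff_conjugate: "x \<le> y \<longleftrightarrow> conjugate (y - x) = y - x \<and> 1 \<bullet> x \<le> 1 \<bullet> y"

instance real :: star_scalar
  by standard simp_all

instance complex :: star_scalar
proof
  fix x y c :: complex
  show "x \<bullet> (c * y) = (conjugate c * x) \<bullet> y"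
    by (simp add: inner_complex_def algebra_simps)
  show "(\<Sum>b\<in>Basis. (c * b) \<bullet> b) = real (card (Basis :: complex set)) * (1 \<bullet> c)"
    by (simp add: Basis_complex_def inner_complex_def)
  show "x \<le> y \<longleftrightarrow> conjugate (y - x) = y - x \<and> 1 \<bullet> x \<le> 1 \<bullet> y"
    by (auto simp: less_eq_complex_def complex_eq_iff)
qed

lemma linear_conjugate: "linear (conjugate :: 'a::star_scalar \<Rightarrow> 'a)"
proof (rule linearI)
  have inner_conjugate: "conjugate c \<bullet> y = 1 \<bullet> (c * y)" for c y :: 'a
    using inner_mult_conjugate[of 1 c y] by simp
  show "conjugate (r *\<^sub>R x) = r *\<^sub>R conjugate x" for r and x :: 'a
    by (rule vector_eq_rdot[THEN iffD1]) (simp add: inner_conjugate)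
qed (rule conjugate_dist_add)

definition mat_endo :: "'a::star_scalar ^ 'n ^ 'n \<Rightarrow> ('a ^ 'n) endo" where
  "mat_endo A = Endo ((*v) A)"

lemma mat_endo_apply [simp]: "mat_endo A \<cdot> v = A *v v"
  by (simp add: mat_endo_def bounded_linear.linear)

lemma linear_mat_endo: "linear mat_endo"
  by (rule linearI; rule endo_eqI)
    (simp_all add: endo.add_left endo.scaleR_left vec_eq_iff matrix_vector_mult_def
      distrib_right sum.distrib scaleR_sum_right)

lemma mat_endo_times: "mat_endo (A ** B) = mat_endo A * mat_endo B"
  by (rule endo_eqI) (simp add: matrix_vector_mul_assoc)

lemma mat_endo_one: "mat_endo (mat 1) = 1"
  by (rule endo_eqI) simp

lemma mat_endo_power: "mat_endo (matrix_power A k) = mat_endo A ^ k"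
  by (induction k) (simp_all add: matrix_power_def mat_endo_one mat_endo_times)

lemma norm_mat_endo: "norm (mat_endo A) = op_norm A"
  unfolding norm_endo_eq_onorm op_norm_def by (rule arg_cong[of _ _ onorm]) (rule ext, simp)

lemma selfadj_mat_endo:
  assumes "self_adjoint A"
  shows "selfadj (mat_endo A)"
  unfolding selfadj_def mat_endo_apply
proof (intro allI)
  fix x y
  have "(A *v x) \<bullet> y = (\<Sum>i\<in>UNIV. \<Sum>j\<in>UNIV. (A $ i $ j * x $ j) \<bullet> y $ i)"
    by (simp add: inner_vec_def matrix_vector_mult_def inner_sum_left)
  also have "\<dots> = (\<Sum>i\<in>UNIV. \<Sum>j\<in>UNIV. x $ j \<bullet> (A $ j $ i * y $ i))"
  proof (intro sum.cong refl)
    fix i j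
    have "A $ i $ j = conjugate (A $ j $ i)"
      using assms unfolding self_adjoint_def by blast
    then show "(A $ i $ j * x $ j) \<bullet> y $ i = x $ j \<bullet> (A $ j $ i * y $ i)"
      by (simp only: inner_mult_conjugate)
  qed
  also have "\<dots> = (\<Sum>j\<in>UNIV. \<Sum>i\<in>UNIV. x $ j \<bullet> (A $ j $ i * y $ i))"
    by (rule sum.swap)
  also have "\<dots> = x \<bullet> (A *v y)"
    by (simp add: inner_vec_def matrix_vector_mult_def inner_sum_right)
  finally show "(A *v x) \<bullet> y = x \<bullet> (A *v y)" .
qed

lemma tr_mat_endo:
  "tr (mat_endo A) = DIM('a) * (1 \<bullet> trace (A :: 'a::star_scalar ^ 'n ^ 'n))"
proof -
  have diag: "(A *v axis i b) $ i = A $ i $ i * b" for i and b :: 'a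
    by (simp add: matrix_vector_mult_def axis_def if_distrib cong: if_cong)
  have "tr (mat_endo A) = (\<Sum>i\<in>UNIV. \<Sum>b\<in>Basis. (A *v axis i b) \<bullet> axis i b)"
    unfolding tr_def Basis_vec_def
    by (subst sum.UNION_disjoint; (subst sum.UNION_disjoint)?)
      (auto simp: axis_eq_axis)
  also have "\<dots> = (\<Sum>i\<in>UNIV. \<Sum>b\<in>Basis. (A $ i $ i * b) \<bullet> b)"
    by (simp add: inner_axis diag)
  finally show ?thesis
    by (simp add: sum_Basis_inner_mult trace_def inner_sum_right sum_distrib_left)
qed

lemma matrix_exp_sums: "(\<lambda>k. matrix_power A k /\<^sub>R fact k) sums matrix_exp (A :: 'a::star_scalar ^ 'n ^ 'n)"
proof -
  have "(\<lambda>k. (matrix_power A k /\<^sub>R fact k) $ i $ j) sums ((exp (mat_endo A) \<cdot> axis j 1) $ i)" for i j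
  proof -
    have entry: "(B *v axis j 1) $ i = B $ i $ j" for B :: "'a ^ 'n ^ 'n"
      by (simp add: matrix_vector_mult_def axis_def if_distrib cong: if_cong)
    have "bounded_linear (\<lambda>T. (T \<cdot> (axis j 1 :: 'a ^ 'n)) $ i)"
      by (intro bounded_linear_compose[OF bounded_linear_vec_nth] endo.bounded_linear_left)
    from bounded_linear.sums[OF this exp_converges[of "mat_endo A"]] show ?thesis
      by (simp add: endo.scaleR_left entry flip: mat_endo_power)
  qed
  then have "(\<lambda>k. matrix_power A k /\<^sub>R fact k) sums (\<chi> i j. (exp (mat_endo A) \<cdot> axis j 1) $ i)"
    unfolding sums_def by (intro vec_tendstoI) simp
  then show ?thesis
    unfolding matrix_exp_def by (simp add: sums_iff)
qed

lemma linear_trace: "linear (trace :: 'a::real_normed_field ^ 'n ^ 'n \<Rightarrow> 'a)"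
  by (rule linearI) (simp_all add: trace_def sum.distrib scaleR_sum_right)

lemma tr_exp_mat_endo:
  "tr (exp (mat_endo A)) = DIM('a) * (1 \<bullet> trace (matrix_exp (A :: 'a::star_scalar ^ 'n ^ 'n)))"
proof (rule sums_unique2)
  have "bounded_linear (\<lambda>B :: 'a ^ 'n ^ 'n. DIM('a) * (1 \<bullet> trace B))"
    by (intro linear_conv_bounded_linear[THEN iffD1] linearI)
      (simp_all add: linear_add[OF linear_trace] linear_cmul[OF linear_trace] inner_add_right
        distrib_left)
  then show "(\<lambda>k. DIM('a) * (1 \<bullet> trace (matrix_power A k /\<^sub>R fact k))) sums
      (DIM('a) * (1 \<bullet> trace (matrix_exp A)))"
    by (rule bounded_linear.sums[OF _ matrix_exp_sums])
  show "(\<lambda>k. DIM('a) * (1 \<bullet> trace (matrix_power A k /\<^sub>R fact k))) sums tr (exp (mat_endo A))"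
    using bounded_linear.sums[OF bounded_linear_tr exp_converges[of "mat_endo A"]]
    by (simp add: linear_cmul[OF linear_mat_endo] flip: tr_mat_endo mat_endo_power)
qed

lemma conjugate_trace_matrix_exp:
  assumes "self_adjoint (A :: 'a::star_scalar ^ 'n ^ 'n)"
  shows "conjugate (trace (matrix_exp A)) = trace (matrix_exp A)"
proof -
  have commute: "A ** matrix_power A k = matrix_power A k ** A" for k
    by (induction k) (simp_all add: matrix_power_def, metis matrix_mul_assoc)
  have power: "matrix_power A k $ i $ j = conjugate (matrix_power A k $ j $ i)" for k i j
  proof (induction k arbitrary: i j)
    case 0
    have "conjugate (1 :: 'a) = 1"
      by (metis conjugate_dist_mul conjugate_id mult.left_neutral mult.right_neutral)
    then show ?case by (auto simp: matrix_power_def mat_def)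
  next
    case (Suc k)
    have "matrix_power A (Suc k) $ i $ j = (\<Sum>l\<in>UNIV. A $ i $ l * matrix_power A k $ l $ j)"
      by (simp add: matrix_power_def matrix_matrix_mult_def)
    also have "\<dots> = (\<Sum>l\<in>UNIV. conjugate (matrix_power A k $ j $ l * A $ l $ i))"
    proof (rule sum.cong[OF refl])
      fix l
      have "A $ i $ l = conjugate (A $ l $ i)"
        using assms unfolding self_adjoint_def by blast
      then show "A $ i $ l * matrix_power A k $ l $ j = conjugate (matrix_power A k $ j $ l * A $ l $ i)"
        unfolding conjugate_dist_mul using Suc.IH[of l j] by (metis mult.commute)
    qed
    also have "\<dots> = conjugate ((A ** matrix_power A k) $ j $ i)"
      by (simp add: commute) (simp add: matrix_matrix_mult_def sum_conjugate)
    finally show ?case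
      by (simp add: matrix_power_def)
  qed
  have conj_tr: "conjugate (trace (matrix_power A k /\<^sub>R fact k)) = trace (matrix_power A k /\<^sub>R fact k)" for k
    by (simp add: linear_cmul[OF linear_trace] linear_cmul[OF linear_conjugate])
      (simp add: trace_def sum_conjugate flip: power)
  have tr_sums: "(\<lambda>k. trace (matrix_power A k /\<^sub>R fact k)) sums trace (matrix_exp A)"
    by (intro bounded_linear.sums[OF _ matrix_exp_sums] linear_conv_bounded_linear[THEN iffD1] linear_trace)
  then have "(\<lambda>k. conjugate (trace (matrix_power A k /\<^sub>R fact k))) sums conjugate (trace (matrix_exp A))"
    by (intro bounded_linear.sums[OF linear_conv_bounded_linear[THEN iffD1, OF linear_conjugate]])
  then show ?thesis
    using tr_sums sums_unique2 unfolding conj_tr by blast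
qed

lemma inner_le_of_loewner_le:
  assumes "A \<preceq>\<^sub>L r *\<^sub>R mat 1"
  shows "v \<bullet> (mat_endo A \<cdot> v) \<le> r * (v \<bullet> v)"
proof -
  let ?B = "r *\<^sub>R mat 1 - A"
  have Bv: "?B *v v = r *\<^sub>R v - A *v v"
    by (simp add: linear_diff[OF linear_mat_endo] linear_cmul[OF linear_mat_endo] mat_endo_one
        endo.diff_left endo.scaleR_left flip: mat_endo_apply)
  have "0 \<le> (\<Sum>i\<in>UNIV. conjugate (v $ i) * (?B *v v) $ i)"
    using assms unfolding loewner_le_def pos_semidef_def by blast
  then have "0 \<le> 1 \<bullet> (\<Sum>i\<in>UNIV. conjugate (v $ i) * (?B *v v) $ i)"
    unfolding less_eq_iff_conjugate[of 0] by simp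
  also have "\<dots> = v \<bullet> (?B *v v)"
    by (simp add: inner_vec_def inner_sum_right inner_mult_conjugate)
  finally show ?thesis
    by (simp add: Bv inner_diff_right)
qed

lemma self_adjoint_scaleR:
  "self_adjoint A \<Longrightarrow> self_adjoint (r *\<^sub>R A :: 'a::star_scalar ^ 'n ^ 'n)"
  unfolding self_adjoint_def vector_scaleR_component linear_cmul[OF linear_conjugate] by metis

lemma self_adjoint_add: "self_adjoint A \<Longrightarrow> self_adjoint B \<Longrightarrow> self_adjoint (A + B)"
  unfolding self_adjoint_def vector_add_component conjugate_dist_add by metis

lemma self_adjoint_uminus: "self_adjoint A \<Longrightarrow> self_adjoint (- A)"
  unfolding self_adjoint_def vector_uminus_component conjugate_neg by metis

lemma conjugate_sym_exp_potential:
  assumes "self_adjoint (Y :: 'a::star_scalar ^ 'n ^ 'n)"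
  shows "conjugate (sym_exp_potential \<delta> Y) = sym_exp_potential \<delta> Y"
  using assms by (simp add: sym_exp_potential_def conjugate_dist_add conjugate_trace_matrix_exp
      self_adjoint_scaleR self_adjoint_uminus)

lemma inner_sym_exp_potential:
  "DIM('a) * (1 \<bullet> sym_exp_potential \<delta> (Y :: 'a::star_scalar ^ 'n ^ 'n))
    = tr (exp (\<delta> *\<^sub>R mat_endo Y)) + tr (exp (\<delta> *\<^sub>R - mat_endo Y))"
  by (simp add: sym_exp_potential_def inner_add_right distrib_left linear_cmul[OF linear_mat_endo]
      linear_neg[OF linear_mat_endo] flip: tr_exp_mat_endo)

lemma mat_endo_sum_scaleR: "mat_endo (\<Sum>i\<in>I. l i *\<^sub>R X i) = (\<Sum>i\<in>I. l i *\<^sub>R mat_endo (X i))"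
  unfolding linear_sum[OF linear_mat_endo] linear_cmul[OF linear_mat_endo] ..

theorem sum_sym_exp_potential_le:
  fixes X :: "'i \<Rightarrow> 'a::star_scalar ^ 'n ^ 'n"
  assumes l: "\<And>i. i \<in> I \<Longrightarrow> 0 \<le> l i" "sum l I = 1"
    and X: "\<And>i. i \<in> I \<Longrightarrow> self_adjoint (X i)" "\<And>i. i \<in> I \<Longrightarrow> op_norm (X i) \<le> M"
    and mean: "(\<Sum>i\<in>I. l i *\<^sub>R X i) = 0"
    and var: "(\<Sum>i\<in>I. l i *\<^sub>R (X i ** X i)) \<preceq>\<^sub>L M' *\<^sub>R mat 1"
    and Y: "self_adjoint Y" and M: "0 < M" and \<delta>: "0 \<le> \<delta>"
  defines "c \<equiv> exp (M' * psi M \<delta>)"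
  shows "(\<Sum>i\<in>I. l i *\<^sub>R sym_exp_potential \<delta> (Y + X i)) \<le> c *\<^sub>R sym_exp_potential \<delta> Y"
    and "\<exists>i\<in>I. sym_exp_potential \<delta> (Y + X i) \<le> c *\<^sub>R sym_exp_potential \<delta> Y"
proof -
  let ?X = "\<lambda>i. mat_endo (X i)" and ?Y = "mat_endo Y"
  let ?F = "\<lambda>i. sym_exp_potential \<delta> (Y + X i)"
  have mean': "(\<Sum>i\<in>I. l i *\<^sub>R ?X i) = 0"
    unfolding mat_endo_sum_scaleR[symmetric] mean by (rule linear_0[OF linear_mat_endo])
  have var': "v \<bullet> ((\<Sum>i\<in>I. l i *\<^sub>R (?X i * ?X i)) \<cdot> v) \<le> M' * (v \<bullet> v)" for v
    using inner_le_of_loewner_le[OF var, of v] unfolding mat_endo_sum_scaleR mat_endo_times .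
  have pos: "(\<Sum>i\<in>I. l i * tr (exp (\<delta> *\<^sub>R (?Y + ?X i)))) \<le> c * tr (exp (\<delta> *\<^sub>R ?Y))"
    unfolding c_def using l X mean' var' Y M \<delta>
    by (intro sum_tr_exp_le) (simp_all add: selfadj_mat_endo norm_mat_endo)
  have "(\<Sum>i\<in>I. l i * tr (exp (\<delta> *\<^sub>R (- ?Y + - ?X i)))) \<le> c * tr (exp (\<delta> *\<^sub>R - ?Y))"
    unfolding c_def using l X mean' var' Y M \<delta>
    by (intro sum_tr_exp_le)
      (simp_all add: selfadj_mat_endo selfadj_uminus norm_mat_endo sum_negf)
  moreover have "DIM('a) * (1 \<bullet> (\<Sum>i\<in>I. l i *\<^sub>R ?F i))
      = (\<Sum>i\<in>I. l i * tr (exp (\<delta> *\<^sub>R (?Y + ?X i)))) + (\<Sum>i\<in>I. l i * tr (exp (\<delta> *\<^sub>R (- ?Y + - ?X i))))"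
  proof -
    have "DIM('a) * (1 \<bullet> (\<Sum>i\<in>I. l i *\<^sub>R ?F i)) = (\<Sum>i\<in>I. l i * (DIM('a) * (1 \<bullet> ?F i)))"
      unfolding inner_sum_right sum_distrib_left inner_scaleR_right mult.left_commute[of "real DIM('a)"] ..
    also have "\<dots> = (\<Sum>i\<in>I. l i * (tr (exp (\<delta> *\<^sub>R (?Y + ?X i))) + tr (exp (\<delta> *\<^sub>R (- ?Y + - ?X i)))))"
      unfolding inner_sym_exp_potential linear_add[OF linear_mat_endo] minus_add_distrib ..
    finally show ?thesis
      unfolding distrib_left sum.distrib .
  qed
  moreover have "DIM('a) * (1 \<bullet> (c *\<^sub>R sym_exp_potential \<delta> Y))
      = c * tr (exp (\<delta> *\<^sub>R ?Y)) + c * tr (exp (\<delta> *\<^sub>R - ?Y))"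
    unfolding inner_scaleR_right mult.left_commute[of _ c] inner_sym_exp_potential distrib_left ..
  ultimately have "DIM('a) * (1 \<bullet> (\<Sum>i\<in>I. l i *\<^sub>R ?F i)) \<le> DIM('a) * (1 \<bullet> (c *\<^sub>R sym_exp_potential \<delta> Y))"
    using pos by linarith
  then have inner_le: "1 \<bullet> (\<Sum>i\<in>I. l i *\<^sub>R ?F i) \<le> 1 \<bullet> (c *\<^sub>R sym_exp_potential \<delta> Y)"
    by (rule mult_left_le_imp_le) simp
  have le_iff: "x \<le> y \<longleftrightarrow> 1 \<bullet> x \<le> 1 \<bullet> y" if "conjugate x = x" "conjugate y = y" for x y :: 'a
    unfolding less_eq_iff_conjugate[of x y] using that by (simp add: linear_diff[OF linear_conjugate])
  have conj_F: "conjugate (?F i) = ?F i" if "i \<in> I" for i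
    using that X Y by (intro conjugate_sym_exp_potential self_adjoint_add) auto
  have conj_Y: "conjugate (c *\<^sub>R sym_exp_potential \<delta> Y) = c *\<^sub>R sym_exp_potential \<delta> Y"
    using Y by (simp add: linear_cmul[OF linear_conjugate] conjugate_sym_exp_potential)
  have "conjugate (\<Sum>i\<in>I. l i *\<^sub>R ?F i) = (\<Sum>i\<in>I. l i *\<^sub>R ?F i)"
    by (simp add: linear_sum[OF linear_conjugate] linear_cmul[OF linear_conjugate] conj_F)
  then show "(\<Sum>i\<in>I. l i *\<^sub>R ?F i) \<le> c *\<^sub>R sym_exp_potential \<delta> Y"
    using inner_le conj_Y le_iff by blast
  show "\<exists>i\<in>I. ?F i \<le> c *\<^sub>R sym_exp_potential \<delta> Y"
  proof (rule ccontr)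
    define r where "r = 1 \<bullet> (c *\<^sub>R sym_exp_potential \<delta> Y)"
    assume "\<not> ?thesis"
    then have less: "r < 1 \<bullet> ?F i" if "i \<in> I" for i
      using that le_iff[OF conj_F conj_Y] by (auto simp: r_def not_le)
    have "finite I"
      using l(2) sum.infinite by fastforce
    obtain j where "j \<in> I" "0 < l j"
      using l by (metis less_eq_real_def sum.neutral zero_neq_one)
    then have "(\<Sum>i\<in>I. l i * r) < (\<Sum>i\<in>I. l i * (1 \<bullet> ?F i))"
      using \<open>finite I\<close> l(1) less
      by (intro sum_strict_mono_ex1 ballI bexI[of _ j] mult_left_mono mult_strict_left_mono)
        (auto intro: less_imp_le)
    also have "\<dots> \<le> r"
      using inner_le by (simp add: r_def inner_sum_right)
    finally show False
      using l(2) by (simp flip: sum_distrib_right)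
  qed
qed

theorem theorem2p1:
  fixes m :: nat and l :: "nat \<Rightarrow> real" and M\<^sub>1 M\<^sub>2 \<delta> :: real
  assumes "m \<ge> 1"
    and "\<forall>i\<in>{1..m}. l i \<ge> 0"
    and "(\<Sum>i = 1..m. l i) = 1"
    and "M\<^sub>1 > 0"
    and "\<delta> > 0"
  shows "(\<forall>(X :: nat \<Rightarrow> real ^ 'd ^ 'd) (Y :: real ^ 'd ^ 'd).
            (\<forall>i\<in>{1..m}. self_adjoint (X i)) \<longrightarrow>
            (\<Sum>i = 1..m. l i *\<^sub>R X i) = 0 \<longrightarrow>
            (\<forall>i\<in>{1..m}. op_norm (X i) \<le> M\<^sub>1) \<longrightarrow>
            (\<Sum>i = 1..m. l i *\<^sub>R (X i ** X i)) \<preceq>\<^sub>L M\<^sub>2 *\<^sub>R mat 1 \<longrightarrow>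
            self_adjoint Y \<longrightarrow>
              (\<Sum>i = 1..m. l i *\<^sub>R sym_exp_potential \<delta> (Y + X i))
                \<le> exp (M\<^sub>2 * psi M\<^sub>1 \<delta>) *\<^sub>R sym_exp_potential \<delta> Y \<and>
              (\<exists>i\<in>{1..m}. sym_exp_potential \<delta> (Y + X i)
                \<le> exp (M\<^sub>2 * psi M\<^sub>1 \<delta>) *\<^sub>R sym_exp_potential \<delta> Y))
       \<and> (\<forall>(X :: nat \<Rightarrow> complex ^ 'd ^ 'd) (Y :: complex ^ 'd ^ 'd).
            (\<forall>i\<in>{1..m}. self_adjoint (X i)) \<longrightarrow>
            (\<Sum>i = 1..m. l i *\<^sub>R X i) = 0 \<longrightarrow>
            (\<forall>i\<in>{1..m}. op_norm (X i) \<le> M\<^sub>1) \<longrightarrow>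
            (\<Sum>i = 1..m. l i *\<^sub>R (X i ** X i)) \<preceq>\<^sub>L M\<^sub>2 *\<^sub>R mat 1 \<longrightarrow>
            self_adjoint Y \<longrightarrow>
              (\<Sum>i = 1..m. l i *\<^sub>R sym_exp_potential \<delta> (Y + X i))
                \<le> exp (M\<^sub>2 * psi M\<^sub>1 \<delta>) *\<^sub>R sym_exp_potential \<delta> Y \<and>
              (\<exists>i\<in>{1..m}. sym_exp_potential \<delta> (Y + X i)
                \<le> exp (M\<^sub>2 * psi M\<^sub>1 \<delta>) *\<^sub>R sym_exp_potential \<delta> Y))"
proof -
  note main = sum_sym_exp_potential_le[where I = "{1..m}" and l = l,
      OF _ assms(3) _ _ _ _ _ assms(4) less_imp_le[OF assms(5)]]
  show ?thesis
    by (intro conjI allI impI; rule main; use assms(2) in blast)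
qed

end
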